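(* Let $\boldsymbol\varphi:[0,L]\times[t_1,t_2]\to\mathbb R^3$ and $\mathbf R:[0,L]\times[t_1,t_2]\to SO(3)$ be smooth, with associated velocity $\boldsymbol v$, spin $\boldsymbol\omega$, strain-vector $\boldsymbol\varepsilon$ and curvature $\boldsymbol\kappa$. Consider smooth variations $(\delta\boldsymbol\varphi,\delta\boldsymbol\theta)$ satisfying $\delta\boldsymbol\varphi(S,t_i)=0$ and $\delta\boldsymbol\theta(S,t_i)=0$ for $i=1,2$ and all $S\in[0,L]$, and satisfying at every time $t$ and at $S=0$ and $S=L$ the boundary conditions $\langle\delta\boldsymbol\varphi,\mathbb G\boldsymbol\varepsilon\rangle=\langle\delta\boldsymbol\theta,\mathbb H\boldsymbol\kappa\rangle=0$. For such variations, Hamilton's principle $\delta\mathcal S=0$ for the action $$\mathcal S=\int_{t_1}^{t_2}\int_0^L\left(\tfrac12\langle\boldsymbol v,\mathbb A\boldsymbol v\rangle+\tfrac12\langle\boldsymbol\omega,\mathbb J\boldsymbol\omega\rangle-\tfrac12\langle\boldsymbol\varepsilon,\mathbb G\boldsymbol\varepsilon\rangle-\tfrac12\langle\boldsymbol\kappa,\mathbb H\boldsymbol\kappa\rangle\right)dS\,dt$$ is equivalent to $$\int_{t_1}^{t_2}\int_0^L\left[\delta\boldsymbol\varphi\cdot\left(\frac{\partial(\mathbb G\boldsymbol\varepsilon)}{\partial S}-\frac{\partial(\mathbb A\boldsymbol v)}{\partial t}\right)+\delta\boldsymbol\theta\cdot\left(\frac{\partial(\mathbb H\boldsymbol\kappa)}{\partial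 S}+\frac{\partial\boldsymbol\varphi}{\partial S}\wedge(\mathbb G\boldsymbol\varepsilon)-\frac{\partial(\mathbb J\boldsymbol\omega)}{\partial t}\right)\right]dS\,dt=0 .$$
   Context: $\langle\cdot,\cdot\rangle$ and $\cdot$ denote the Euclidean scalar product on $\mathbb R^3$ and $\wedge$ the cross product. $(\boldsymbol e_1,\boldsymbol e_2,\boldsymbol e_3)$ is a fixed positively oriented orthonormal basis, identified with the canonical basis of $\mathbb R^3$. The moving frame is $\boldsymbol d_i(S,t)=\mathbf R(S,t)\boldsymbol e_i$. A bold vector $\boldsymbol u=u_i\boldsymbol d_i$ is a vector of the ambient $\mathbb R^3$; the column $u=(u_1,u_2,u_3)^T=\mathbf R^{-1}\boldsymbol u$ is its column of moving-frame components. Partial derivatives of bold vectors are those of $\mathbb R^3$-valued functions (the frame is differentiated too). The map $j:so(3)\to\mathbb R^3$ sends a skew matrix $A$ to the column $a$ with $Ax=a\wedge x$ for all $x$. The curvature $\boldsymbol\kappa$ is the bold vector with moving components $j(\mathbf R^{-1}\partial_S\mathbf R)$ and the spin $\boldsymbol\omega$ is the bold vector with moving components $j(\mathbf R^{-1}\partial_t\mathbf R)$; thus $\partial_S\boldsymbol d_i=\boldsymbol\kappa\wedge\boldsymbol d_i$ and $\partial_t\boldsymbol d_i=\boldsymbol\omega\wedge\boldsymbol d_i$. Moreover $\boldsymbol\varepsilon:=\partial_S\boldsymbol\varphi-\boldsymbol d_3$ and $\boldsymbol v:=\partial_t\boldsymbol\varphi$. The tensors are diagonal with constant positive entries in the moving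 frame $\{\boldsymbol d_i\}$: $\mathbb G=\mathrm{diag}(GA,GA,EA)$, $\mathbb H=\mathrm{diag}(EI_1,EI_2,GI_3)$, $\mathbb A=\rho A\,\mathrm{Id}$, $\mathbb J=\rho\,\mathrm{diag}(I_1,I_2,I_3)$; applied to a bold vector, $\mathbb X\boldsymbol u$ is the bold vector with moving components $\mathbb X u$. Variations: for a smooth one-parameter family $(\boldsymbol\varphi_\nu,\mathbf R_\nu)$ with $(\boldsymbol\varphi_0,\mathbf R_0)=(\boldsymbol\varphi,\mathbf R)$, $\delta$ denotes $\frac{d}{d\nu}|_{\nu=0}$, and $\delta\boldsymbol\theta$ is the bold vector with moving components $j(\mathbf R^{-1}\delta\mathbf R)$, so that $\delta\boldsymbol d_i=\delta\boldsymbol\theta\wedge\boldsymbol d_i$. *)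

theory Defs
  imports "HOL-Analysis.Analysis"
begin

text \<open>Smoothness on a set that need not be open (closed rectangles, boxes): derivatives are taken
  within the set. On a convex set with nonempty interior they are unique, boundary points
  included, and continuity of all directional derivatives is continuity of the derivative.\<close>

primrec Ck_on ::
  "nat \<Rightarrow> 'a::euclidean_space set \<Rightarrow> ('a \<Rightarrow> 'b::real_normed_vector) \<Rightarrow> bool" where
  "Ck_on 0 D f \<longleftrightarrow> continuous_on D f"
| "Ck_on (Suc k) D f \<longleftrightarrow>
     (\<exists>f'. (\<forall>x\<in>D. (f has_derivative f' x) (at x within D)) \<and> (\<forall>v. Ck_on k D (\<lambda>x. f' x v)))"

definition smooth_on ::
  "'a::euclidean_space set \<Rightarrow> ('a \<Rightarrow> 'b::real_normed_vector) \<Rightarrow> bool" where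
  "smooth_on D f \<longleftrightarrow> (\<forall>k. Ck_on k D f)"

text \<open>Partial derivatives on the rectangle \<open>{0..L} \<times> {t1..t2}\<close>, one-sided on its edges.\<close>

definition pd_S ::
  "real \<Rightarrow> (real \<Rightarrow> real \<Rightarrow> 'b::real_normed_vector) \<Rightarrow> real \<Rightarrow> real \<Rightarrow> 'b" where
  "pd_S L f S t = vector_derivative (\<lambda>s. f s t) (at S within {0..L})"

definition pd_t ::
  "real \<Rightarrow> real \<Rightarrow> (real \<Rightarrow> real \<Rightarrow> 'b::real_normed_vector) \<Rightarrow> real \<Rightarrow> real \<Rightarrow> 'b" where
  "pd_t t1 t2 f S t = vector_derivative (\<lambda>\<tau>. f S \<tau>) (at t within {t1..t2})"

text \<open>The map \<open>j\<close> from skew matrices to vectors (unspecified on other matrices).\<close>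

definition axial :: "real^3^3 \<Rightarrow> real^3" where
  "axial M = (THE a. \<forall>x. M *v x = cross3 a x)"

definition diag3 :: "real \<Rightarrow> real \<Rightarrow> real \<Rightarrow> real^3^3" where
  "diag3 a b c = (\<chi> i j. if i = j then vector [a, b, c] $ i else 0)"

text \<open>All vector fields below are vectors of the ambient space. A field with moving components
  \<open>u\<close> is \<open>R *v u\<close>, since the directors are \<open>R *v axis i 1\<close>; a tensor is given by its matrix \<open>X\<close>
  in the moving frame.\<close>

definition apply_tensor ::
  "real^3^3 \<Rightarrow> (real \<Rightarrow> real \<Rightarrow> real^3^3) \<Rightarrow> (real \<Rightarrow> real \<Rightarrow> real^3) \<Rightarrow> real \<Rightarrow> real \<Rightarrow> real^3" where
  "apply_tensor X R u S t = R S t *v (X *v (matrix_inv (R S t) *v u S t))"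

definition curvature :: "real \<Rightarrow> (real \<Rightarrow> real \<Rightarrow> real^3^3) \<Rightarrow> real \<Rightarrow> real \<Rightarrow> real^3" where
  "curvature L R S t = R S t *v axial (matrix_inv (R S t) ** pd_S L R S t)"

definition spin :: "real \<Rightarrow> real \<Rightarrow> (real \<Rightarrow> real \<Rightarrow> real^3^3) \<Rightarrow> real \<Rightarrow> real \<Rightarrow> real^3" where
  "spin t1 t2 R S t = R S t *v axial (matrix_inv (R S t) ** pd_t t1 t2 R S t)"

definition strain ::
  "real \<Rightarrow> (real \<Rightarrow> real \<Rightarrow> real^3) \<Rightarrow> (real \<Rightarrow> real \<Rightarrow> real^3^3) \<Rightarrow> real \<Rightarrow> real \<Rightarrow> real^3" where
  "strain L \<phi> R S t = pd_S L \<phi> S t - R S t *v axis 3 1"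

definition velocity ::
  "real \<Rightarrow> real \<Rightarrow> (real \<Rightarrow> real \<Rightarrow> real^3) \<Rightarrow> real \<Rightarrow> real \<Rightarrow> real^3" where
  "velocity t1 t2 \<phi> S t = pd_t t1 t2 \<phi> S t"

definition action ::
  "real \<Rightarrow> real \<Rightarrow> real \<Rightarrow> real^3^3 \<Rightarrow> real^3^3 \<Rightarrow> real^3^3 \<Rightarrow> real^3^3 \<Rightarrow>
   (real \<Rightarrow> real \<Rightarrow> real^3) \<Rightarrow> (real \<Rightarrow> real \<Rightarrow> real^3^3) \<Rightarrow> real" where
  "action L t1 t2 AA JJ GG HH \<phi> R =
     integral {t1..t2} (\<lambda>t. integral {0..L} (\<lambda>S.
         1/2 * (velocity t1 t2 \<phi> S t \<bullet> apply_tensor AA R (velocity t1 t2 \<phi>) S t)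
       + 1/2 * (spin t1 t2 R S t \<bullet> apply_tensor JJ R (spin t1 t2 R) S t)
       - 1/2 * (strain L \<phi> R S t \<bullet> apply_tensor GG R (strain L \<phi> R) S t)
       - 1/2 * (curvature L R S t \<bullet> apply_tensor HH R (curvature L R) S t)))"

text \<open>Variations induced by a one-parameter family, whose parameter is the first argument.\<close>

definition var_\<phi> :: "(real \<Rightarrow> real \<Rightarrow> real \<Rightarrow> real^3) \<Rightarrow> real \<Rightarrow> real \<Rightarrow> real^3" where
  "var_\<phi> \<Phi> S t = vector_derivative (\<lambda>\<nu>. \<Phi> \<nu> S t) (at 0)"

definition var_\<theta> :: "(real \<Rightarrow> real \<Rightarrow> real \<Rightarrow> real^3^3) \<Rightarrow> real \<Rightarrow> real \<Rightarrow> real^3" where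
  "var_\<theta> Q S t =
     Q 0 S t *v axial (matrix_inv (Q 0 S t) ** vector_derivative (\<lambda>\<nu>. Q \<nu> S t) (at 0))"

end

theory Submission
  imports Defs
begin

text \<open>Write \<open>P\<close> for the rotation field of the family, \<open>w\<close>, \<open>k\<close>, \<open>e\<close>, \<open>\<theta>\<close> for the moving components of
  spin, curvature, strain and \<open>\<delta>\<theta>\<close>, and let \<open>\<delta>\<close> act on components. Then
  \<open>P (\<delta> w) = \<partial>\<^sub>t \<delta>\<theta>\<close>, \<open>P (\<delta> k) = \<partial>\<^sub>S \<delta>\<theta>\<close> and \<open>P (\<delta> e) = \<partial>\<^sub>S \<delta>\<phi> - \<delta>\<theta> \<and> \<partial>\<^sub>S \<phi>\<close> as ambient vectors, so
  the variation of the Lagrangian density is the integrand of the weak equations of motion plus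
  \<open>\<partial>\<^sub>t (\<delta>\<phi> \<bullet> A v + \<delta>\<theta> \<bullet> J \<omega>) - \<partial>\<^sub>S (\<delta>\<phi> \<bullet> G \<epsilon> + \<delta>\<theta> \<bullet> H \<kappa>)\<close>. The conditions on the variations make both
  divergence terms integrate to zero, so the action is always differentiable at \<open>\<nu> = 0\<close> and its
  derivative is exactly the weak form.\<close>

section \<open>Smooth fields on boxes and their partial derivatives\<close>

lemma Ck_on_imp_continuous_on: "Ck_on k D f \<Longrightarrow> continuous_on D f"
  by (cases k) (auto simp: continuous_on_eq_continuous_within intro: has_derivative_continuous)

text \<open>The partials are the total derivative applied to the coordinate vectors, and
  \<open>Ck_on\<close> asks for regularity of the derivative in each fixed direction, so they are of
  class \<open>k\<close> at once. The derivative along a coordinate segment comes from the chain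
  rule within the image of that segment, which covers boundary points.\<close>

lemma Ck_on_Suc_partials:
  fixes f :: "real \<times> real \<times> real \<Rightarrow> 'b::real_normed_vector"
  assumes "Ck_on (Suc k) (U \<times> I \<times> J) f"
  obtains f1 f2 f3 where "Ck_on k (U \<times> I \<times> J) f1" "Ck_on k (U \<times> I \<times> J) f2" "Ck_on k (U \<times> I \<times> J) f3"
    and "\<And>x y z. x \<in> U \<Longrightarrow> y \<in> I \<Longrightarrow> z \<in> J \<Longrightarrow>
           ((\<lambda>x. f (x, y, z)) has_vector_derivative f1 (x, y, z)) (at x within U)"
    and "\<And>x y z. x \<in> U \<Longrightarrow> y \<in> I \<Longrightarrow> z \<in> J \<Longrightarrow>
           ((\<lambda>y. f (x, y, z)) has_vector_derivative f2 (x, y, z)) (at y within I)"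
    and "\<And>x y z. x \<in> U \<Longrightarrow> y \<in> I \<Longrightarrow> z \<in> J \<Longrightarrow>
           ((\<lambda>z. f (x, y, z)) has_vector_derivative f3 (x, y, z)) (at z within J)"
proof -
  let ?D = "U \<times> I \<times> J"
  from assms obtain f' where f': "\<And>p. p \<in> ?D \<Longrightarrow> (f has_derivative f' p) (at p within ?D)"
    and Ck: "\<And>v. Ck_on k ?D (\<lambda>p. f' p v)"
    by auto
  have line: "((\<lambda>s. f (g s)) has_vector_derivative f' (g s) v) (at s within T)"
    if "(g has_vector_derivative v) (at s within T)" "g ` T \<subseteq> ?D" "s \<in> T" for g v s T
  proof -
    have "(f has_derivative f' (g s)) (at (g s) within g ` T)"
      using that by (intro has_derivative_subset[OF f']) auto
    from vector_derivative_diff_chain_within[OF that(1) this] show ?thesis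
      by (simp add: o_def)
  qed
  show thesis
  proof (rule that[OF Ck Ck Ck])
    fix x y z assume xyz: "x \<in> U" "y \<in> I" "z \<in> J"
    show "((\<lambda>x. f (x, y, z)) has_vector_derivative f' (x, y, z) (1, 0, 0)) (at x within U)"
      using xyz by (intro line has_vector_derivative_Pair has_vector_derivative_const
        has_vector_derivative_id) auto
    show "((\<lambda>y. f (x, y, z)) has_vector_derivative f' (x, y, z) (0, 1, 0)) (at y within I)"
      using xyz by (intro line has_vector_derivative_Pair has_vector_derivative_const
        has_vector_derivative_id) auto
    show "((\<lambda>z. f (x, y, z)) has_vector_derivative f' (x, y, z) (0, 0, 1)) (at z within J)"
      using xyz by (intro line has_vector_derivative_Pair has_vector_derivative_const
        has_vector_derivative_id) auto
  qed
qed

text \<open>Differentiating \<open>f x y = f x a + \<integral>\<^sub>a\<^sup>y f\<^sub>y x\<close> under the integral sign, rather than using the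
  symmetry of second derivatives, covers the end points of \<open>{a..b}\<close> as well.\<close>

lemma mixed_partials_interchange:
  fixes f :: "real \<Rightarrow> real \<Rightarrow> 'b::banach"
  assumes U: "open U" "convex U"
    and fx: "\<And>x y. x \<in> U \<Longrightarrow> y \<in> {a..b} \<Longrightarrow> ((\<lambda>x. f x y) has_vector_derivative fx x y) (at x within U)"
    and fy: "\<And>x y. x \<in> U \<Longrightarrow> y \<in> {a..b} \<Longrightarrow> ((\<lambda>y. f x y) has_vector_derivative fy x y) (at y within {a..b})"
    and fyx: "\<And>x y. x \<in> U \<Longrightarrow> y \<in> {a..b} \<Longrightarrow> ((\<lambda>x. fy x y) has_vector_derivative fyx x y) (at x within U)"
    and cont_fy: "\<And>x. x \<in> U \<Longrightarrow> continuous_on {a..b} (fy x)"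
    and cont_fyx: "continuous_on (U \<times> {a..b}) (\<lambda>(x, y). fyx x y)"
    and xy: "x \<in> U" "y \<in> {a..b}"
  shows "((\<lambda>y. fx x y) has_vector_derivative fyx x y) (at y within {a..b})"
proof -
  \<comment> \<open>Both sides are the derivative of \<open>f x z\<close> in \<open>x\<close>, one
    by differentiating under the integral sign, the other by hypothesis; they agree because
    \<open>U\<close> is open. This exhibits \<open>fx x\<close> as a primitive of
    \<open>fyx x\<close>.\<close>
  have fx_eq: "fx x a + integral {a..z} (fyx x) = fx x z" if z: "z \<in> {a..b}" for z
  proof -
    have "((\<lambda>x. integral (cbox a z) (fy x)) has_vector_derivative integral (cbox a z) (fyx x))
        (at x within U)"
    proof (rule leibniz_rule_vector_derivative)
      show "(fy u) integrable_on cbox a z" if "u \<in> U" for u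
        unfolding box_real using z
        by (intro integrable_continuous_interval continuous_on_subset[OF cont_fy[OF that]]) auto
      show "continuous_on (U \<times> cbox a z) (\<lambda>(x, y). fyx x y)"
        using z by (intro continuous_on_subset[OF cont_fyx]) auto
    qed (use z xy U fyx in auto)
    moreover have "((\<lambda>x. f x a) has_vector_derivative fx x a) (at x within U)"
      using xy z by (intro fx) auto
    ultimately have "((\<lambda>x. f x a + integral {a..z} (fy x)) has_vector_derivative
        fx x a + integral {a..z} (fyx x)) (at x within U)"
      by (auto intro!: has_vector_derivative_add)
    moreover have "f u a + integral {a..z} (fy u) = f u z" if "u \<in> U" for u
    proof -
      have "(fy u has_integral f u z - f u a) {a..z}"
        using z that
        by (intro fundamental_theorem_of_calculus has_vector_derivative_within_subset[OF fy]) auto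
      then show ?thesis
        by (simp add: integral_unique)
    qed
    ultimately have "((\<lambda>x. f x z) has_vector_derivative fx x a + integral {a..z} (fyx x)) (at x within U)"
      using xy by (auto intro: has_vector_derivative_transform[rotated 2])
    with fx[OF \<open>x \<in> U\<close> z] show ?thesis
      using at_within_open[OF \<open>x \<in> U\<close> \<open>open U\<close>] by (auto dest: vector_derivative_unique_at)
  qed
  have "continuous_on {a..b} (fyx x)"
    using xy by (intro continuous_on_compose2[OF cont_fyx, of "{a..b}" "Pair x", simplified])
      (auto intro!: continuous_intros)
  then have "((\<lambda>z. fx x a + integral {a..z} (fyx x)) has_vector_derivative 0 + fyx x y) (at y within {a..b})"
    using xy by (intro has_vector_derivative_add has_vector_derivative_const integral_has_vector_derivative)
  then show ?thesis
    using xy fx_eq by (auto intro: has_vector_derivative_transform[rotated 2])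
qed

section \<open>Iterated integrals: differentiation in a parameter and divergence terms\<close>

text \<open>The Leibniz rule for a single integral is applied twice, to the integral over
  \<open>y\<close> and then to the one over \<open>z\<close>. The second application needs the inner
  integral of \<open>g'\<close> to be jointly continuous in the parameter and \<open>z\<close>; this
  is \<open>inner_cont\<close>. Openness of \<open>U\<close> turns the derivative within
  \<open>U\<close> into a full one.\<close>

lemma leibniz_rule_double_integral:
  fixes g :: "real \<times> real \<times> real \<Rightarrow> real"
  assumes U: "open U" "convex U" "x0 \<in> U"
    and g': "\<And>x y z. x \<in> U \<Longrightarrow> y \<in> {a..b} \<Longrightarrow> z \<in> {c..d} \<Longrightarrow>
        ((\<lambda>x. g (x, y, z)) has_real_derivative g' (x, y, z)) (at x within U)"
    and cont: "continuous_on (U \<times> {a..b} \<times> {c..d}) g" "continuous_on (U \<times> {a..b} \<times> {c..d}) g'"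
  shows "((\<lambda>x. integral {c..d} (\<lambda>z. integral {a..b} (\<lambda>y. g (x, y, z)))) has_real_derivative
      integral {c..d} (\<lambda>z. integral {a..b} (\<lambda>y. g' (x0, y, z)))) (at x0)"
proof -
  have inner_cont: "continuous_on (U \<times> {c..d}) (\<lambda>(x, z). integral {a..b} (\<lambda>y. h (x, y, z)))"
    if "continuous_on (U \<times> {a..b} \<times> {c..d}) h" for h :: "real \<times> real \<times> real \<Rightarrow> real"
  proof -
    have "continuous_on ((U \<times> {c..d}) \<times> cbox a b) (\<lambda>(q, y). h (fst q, y, snd q))"
      unfolding split_beta
      by (rule continuous_on_compose2[OF that]) (auto intro!: continuous_intros)
    from integral_continuous_on_param[OF this] show ?thesis
      by (simp add: split_beta)
  qed
  have "((\<lambda>x. integral (cbox c d) (\<lambda>z. integral (cbox a b) (\<lambda>y. g (x, y, z)))) has_field_derivative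
      integral (cbox c d) (\<lambda>z. integral (cbox a b) (\<lambda>y. g' (x0, y, z)))) (at x0 within U)"
  proof (rule leibniz_rule_field_derivative[OF _ _ _ U(3,2)])
    fix x z assume xz: "x \<in> U" "z \<in> cbox c d"
    have slice: "continuous_on {a..b} (\<lambda>y. g (u, y, z))" if "u \<in> U" for u
      using that xz by (intro continuous_on_compose2[OF cont(1)]) (auto intro!: continuous_intros)
    show "((\<lambda>x. integral (cbox a b) (\<lambda>y. g (x, y, z))) has_real_derivative
        integral (cbox a b) (\<lambda>y. g' (x, y, z))) (at x within U)"
    proof (rule leibniz_rule_field_derivative[OF _ _ _ _ U(2)])
      show "continuous_on (U \<times> cbox a b) (\<lambda>(x, y). g' (x, y, z))"
        unfolding split_beta using xz
        by (intro continuous_on_compose2[OF cont(2)]) (auto intro!: continuous_intros)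
    qed (use xz g' slice in \<open>auto intro: integrable_continuous_interval\<close>)
  next
    fix x assume "x \<in> U"
    then have "continuous_on {c..d} (\<lambda>z. (\<lambda>(x, z). integral {a..b} (\<lambda>y. g (x, y, z))) (x, z))"
      by (intro continuous_on_compose2[OF inner_cont[OF cont(1)]] continuous_intros) auto
    then show "(\<lambda>z. integral (cbox a b) (\<lambda>y. g (x, y, z))) integrable_on cbox c d"
      by (simp add: integrable_continuous_interval)
  qed (use inner_cont[OF cont(2)] in simp)
  then show ?thesis
    using at_within_open[OF U(3,1)] by simp
qed

text \<open>This removes the divergence terms from the variation of the action. \<open>Yx\<close> is
  a derivative in the inner variable, so its integral vanishes for each fixed \<open>t\<close>.
  \<open>Xt\<close> is a derivative in the outer variable, so the order of integration is exchanged
  first, by continuity on the rectangle.\<close>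

lemma iterated_integral_partial_derivatives:
  fixes X Xt Y Yx h :: "real \<Rightarrow> real \<Rightarrow> real"
  assumes le: "a \<le> b" "c \<le> d"
    and X: "\<And>x t. x \<in> {a..b} \<Longrightarrow> t \<in> {c..d} \<Longrightarrow>
        ((\<lambda>t. X x t) has_vector_derivative Xt x t) (at t within {c..d})"
    and Y: "\<And>x t. x \<in> {a..b} \<Longrightarrow> t \<in> {c..d} \<Longrightarrow>
        ((\<lambda>x. Y x t) has_vector_derivative Yx x t) (at x within {a..b})"
    and X0: "\<And>x t. x \<in> {a..b} \<Longrightarrow> t \<in> {c, d} \<Longrightarrow> X x t = 0"
    and Y0: "\<And>x t. x \<in> {a, b} \<Longrightarrow> t \<in> {c..d} \<Longrightarrow> Y x t = 0"
    and cont: "continuous_on ({a..b} \<times> {c..d}) (\<lambda>(x, t). Xt x t)"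
      "continuous_on ({a..b} \<times> {c..d}) (\<lambda>(x, t). Yx x t)"
      "continuous_on ({a..b} \<times> {c..d}) (\<lambda>(x, t). h x t)"
  shows "integral {c..d} (\<lambda>t. integral {a..b} (\<lambda>x. h x t + Xt x t - Yx x t)) =
    integral {c..d} (\<lambda>t. integral {a..b} (\<lambda>x. h x t))"
proof -
  have slice: "(\<lambda>x. k x t) integrable_on {a..b}"
    if "continuous_on ({a..b} \<times> {c..d}) (\<lambda>(x, t). k x t)" "t \<in> {c..d}"
    for k :: "real \<Rightarrow> real \<Rightarrow> real" and t
    using that by (intro integrable_continuous_interval
      continuous_on_compose2[OF that(1), of "{a..b}" "\<lambda>x. (x, t)", simplified]) (auto intro!: continuous_intros)
  have outer: "(\<lambda>t. integral {a..b} (\<lambda>x. k x t)) integrable_on {c..d}"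
    if k: "continuous_on ({a..b} \<times> {c..d}) (\<lambda>(x, t). k x t)" for k :: "real \<Rightarrow> real \<Rightarrow> real"
  proof -
    have "continuous_on ({c..d} \<times> cbox a b) (\<lambda>(t, x). k x t)"
      using continuous_on_swap_args[OF k] by simp
    then show ?thesis
      unfolding box_real[symmetric]
      by (intro integrable_continuous integral_continuous_on_param) simp
  qed
  have "integral {c..d} (\<lambda>t. integral {a..b} (\<lambda>x. Xt x t)) =
      integral {a..b} (\<lambda>x. integral {c..d} (\<lambda>t. Xt x t))"
    using integral_swap_continuous[of a c b d Xt] cont(1) by (simp add: cbox_Pair_eq)
  also have "\<dots> = integral {a..b} (\<lambda>x. 0)"
  proof (rule integral_cong)
    fix x assume x: "x \<in> {a..b}"
    have "((\<lambda>t. Xt x t) has_integral X x d - X x c) {c..d}"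
      using le x by (intro fundamental_theorem_of_calculus X) auto
    then show "integral {c..d} (\<lambda>t. Xt x t) = 0"
      using X0 x by (simp add: integral_unique)
  qed
  finally have intX: "integral {c..d} (\<lambda>t. integral {a..b} (\<lambda>x. Xt x t)) = 0"
    by simp
  have intY: "integral {a..b} (\<lambda>x. Yx x t) = 0" if t: "t \<in> {c..d}" for t
  proof -
    have "((\<lambda>x. Yx x t) has_integral Y b t - Y a t) {a..b}"
      using le t by (intro fundamental_theorem_of_calculus Y) auto
    then show ?thesis
      using Y0 t by (simp add: integral_unique)
  qed
  have "integral {c..d} (\<lambda>t. integral {a..b} (\<lambda>x. h x t + Xt x t - Yx x t)) =
      integral {c..d} (\<lambda>t. integral {a..b} (\<lambda>x. h x t) + integral {a..b} (\<lambda>x. Xt x t))"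
    by (rule integral_cong)
      (simp add: intY slice[OF cont(1)] slice[OF cont(2)] slice[OF cont(3)] integrable_add
        Henstock_Kurzweil_Integration.integral_add Henstock_Kurzweil_Integration.integral_diff)
  then show ?thesis
    by (simp add: Henstock_Kurzweil_Integration.integral_add outer[OF cont(1)] outer[OF cont(3)] intX)
qed

section \<open>Skew matrices, axial vectors and orthogonal frames\<close>

text \<open>An explicit formula for \<open>axial\<close> on skew matrices. It is linear on all
  matrices, so it can be differentiated and shown continuous without knowing that its argument is
  skew.\<close>

definition skew_axis :: "real^3^3 \<Rightarrow> real^3" where
  "skew_axis M = vector [M$3$2, M$1$3, M$2$1]"

lemma bounded_linear_skew_axis: "bounded_linear skew_axis"
  unfolding linear_conv_bounded_linear[symmetric]
  by (rule linearI) (simp_all add: skew_axis_def vec_eq_iff forall_3)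

lemma bounded_linear_transpose: "bounded_linear (transpose :: real^'n^'m \<Rightarrow> real^'m^'n)"
  unfolding linear_conv_bounded_linear[symmetric]
  by (rule linearI) (simp_all add: transpose_def vec_eq_iff)

lemma bounded_bilinear_matrix_matrix_mult:
  "bounded_bilinear ((**) :: real^'n^'m \<Rightarrow> real^'k^'n \<Rightarrow> real^'k^'m)"
  unfolding bilinear_conv_bounded_bilinear[symmetric] bilinear_def
  by (auto intro!: linearI simp: matrix_matrix_mult_def vec_eq_iff sum.distrib sum_distrib_left
    distrib_left distrib_right mult.assoc mult.left_commute)

lemma bounded_bilinear_matrix_vector_mult:
  "bounded_bilinear ((*v) :: real^'n^'m \<Rightarrow> real^'n \<Rightarrow> real^'m)"
  unfolding bilinear_conv_bounded_bilinear[symmetric] bilinear_def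
  by (auto intro!: linearI simp: matrix_vector_mult_def vec_eq_iff sum.distrib sum_distrib_left
    distrib_left distrib_right mult.assoc mult.left_commute)

lemmas continuous_on_matrix =
  bounded_bilinear.continuous_on[OF bounded_bilinear_matrix_matrix_mult]
  bounded_bilinear.continuous_on[OF bounded_bilinear_matrix_vector_mult]
  bounded_linear.continuous_on[OF bounded_linear_transpose]
  bounded_linear.continuous_on[OF bounded_linear_skew_axis]

lemmas has_vector_derivative_matrix =
  bounded_bilinear.has_vector_derivative[OF bounded_bilinear_matrix_matrix_mult]
  bounded_bilinear.has_vector_derivative[OF bounded_bilinear_matrix_vector_mult]
  bounded_linear.has_vector_derivative[OF bounded_linear_transpose]
  bounded_linear.has_vector_derivative[OF bounded_linear_skew_axis]

lemma skew_matrix_component: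
  fixes M :: "real^'n^'n"
  assumes "transpose M = - M"
  shows "M $ j $ i = - M $ i $ j" "M $ i $ i = 0"
proof -
  have "transpose M $ i $ j = (- M) $ i $ j" for i j
    using assms by simp
  then have skew: "M $ j $ i = - M $ i $ j" for i j
    unfolding transpose_def vec_lambda_beta vector_uminus_component .
  show "M $ j $ i = - M $ i $ j"
    by (rule skew)
  show "M $ i $ i = 0"
    using skew[of i i] by simp
qed

lemma skew_axis_cross3:
  assumes "transpose M = - M"
  shows "M *v x = cross3 (skew_axis M) x"
  using skew_matrix_component(1)[OF assms, of 1 2] skew_matrix_component(1)[OF assms, of 2 3]
    skew_matrix_component(1)[OF assms, of 3 1] skew_matrix_component(2)[OF assms]
  by (simp add: vec_eq_iff forall_3 matrix_vector_mult_def sum_3 cross3_def skew_axis_def)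

lemma axial_eq_skew_axis:
  assumes "transpose M = - M"
  shows "axial M = skew_axis M"
  unfolding axial_def
proof (rule the_equality)
  show "\<forall>x. M *v x = cross3 (skew_axis M) x"
    using assms by (simp add: skew_axis_cross3)
  fix b assume "\<forall>x. M *v x = cross3 b x"
  then have "cross3 b x = cross3 (skew_axis M) x" for x
    using skew_axis_cross3[OF assms] by simp
  \<comment> \<open>The product of \<open>b\<close> with the first basis vector determines its
    second and third components, the product with the second one its first and third.\<close>
  from this[of "axis 1 1"] this[of "axis 2 1"] show "b = skew_axis M"
    by (simp add: cross3_def vec_eq_iff forall_3 axis_def)
qed

text \<open>The isomorphism of so(3) with the cross product algebra:
  \<open>W *v skew_axis \<Theta>\<close> is the cross product of the two axial vectors. Skewness
  reduces each matrix to three entries, after which the identity is a computation.\<close>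

lemma skew_axis_commutator:
  assumes "transpose W = - W" "transpose \<Theta> = - \<Theta>"
  shows "skew_axis (W ** \<Theta> - \<Theta> ** W) = W *v skew_axis \<Theta>"
proof -
  note skew = skew_matrix_component(1)[OF assms(1)] skew_matrix_component(1)[OF assms(2)]
  show ?thesis
    using skew[of 1 2] skew[of 2 3] skew[of 3 1] assms[THEN skew_matrix_component(2)]
    by (simp add: vec_eq_iff forall_3 matrix_vector_mult_def matrix_matrix_mult_def sum_3 skew_axis_def
      algebra_simps)
qed

lemma orthogonal_matrix_inv:
  fixes P :: "real^'n^'n"
  assumes "orthogonal_matrix P"
  shows "matrix_inv P = transpose P"
proof -
  have "\<exists>B. P ** B = mat 1 \<and> B ** P = mat 1"
    using assms by (auto simp: orthogonal_matrix_def)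
  then have "matrix_inv P ** P = mat 1"
    unfolding matrix_inv_def by (rule someI2_ex) simp
  then have "matrix_inv P ** (P ** transpose P) = transpose P"
    by (simp add: matrix_mul_assoc)
  then show ?thesis
    using assms by (simp add: orthogonal_matrix_def)
qed

text \<open>Differentiate the constraint \<open>transpose (P s) ** P s = mat 1\<close>.
  Nontriviality of the filter makes the derivative of the constant unique, also at an end point of
  an interval.\<close>

lemma orthogonal_derivative_skew:
  fixes P :: "real \<Rightarrow> real^'n^'n"
  assumes P: "(P has_vector_derivative P') (at s within T)"
    and orth: "\<And>s. s \<in> T \<Longrightarrow> orthogonal_matrix (P s)"
    and s: "s \<in> T" "at s within T \<noteq> bot"
  shows "transpose (transpose (P s) ** P') = - (transpose (P s) ** P')"
proof -
  have "((\<lambda>s. transpose (P s) ** P s) has_vector_derivative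
      transpose (P s) ** P' + transpose P' ** P s) (at s within T)"
    by (intro has_vector_derivative_matrix P)
  then have "((\<lambda>s. mat 1 :: real^'n^'n) has_vector_derivative
      transpose (P s) ** P' + transpose P' ** P s) (at s within T)"
    by (rule has_vector_derivative_transform[OF s(1), rotated])
      (use orth in \<open>simp add: orthogonal_matrix\<close>)
  then have "transpose (P s) ** P' + transpose P' ** P s = 0"
    using vector_derivative_unique_within[OF s(2) _ has_vector_derivative_const] by blast
  then show ?thesis
    by (simp add: matrix_transpose_mul add_eq_0_iff)
qed

text \<open>The classical relation \<open>\<delta>\<omega> = \<partial>\<^sub>t\<delta>\<theta> + \<omega> \<times> \<delta>\<theta>\<close> in moving components, written for the
  ambient vectors, where the cross product is absorbed by the derivative of the frame.\<close>

lemma frame_rate_variation: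
  assumes P: "orthogonal_matrix P"
    and W: "transpose (transpose P ** Pt) = - (transpose P ** Pt)"
    and \<Theta>: "transpose (transpose P ** Pn) = - (transpose P ** Pn)"
  shows "P *v skew_axis (transpose P ** Ptn + transpose Pt ** Pn) + Pt *v skew_axis (transpose P ** Pn) =
    P *v skew_axis (transpose P ** Ptn + transpose Pn ** Pt)"
proof -
  define W where "W = transpose P ** Pt"
  define \<Theta> where "\<Theta> = transpose P ** Pn"
  have skew: "transpose W = - W" "transpose \<Theta> = - \<Theta>"
    using assms by (simp_all add: W_def \<Theta>_def)
  have PP: "P ** transpose P = mat 1"  "transpose P ** P = mat 1"
    using P by (simp_all add: orthogonal_matrix_def)
  have Pt: "Pt = P ** W" and Pn: "Pn = P ** \<Theta>"
    by (simp_all add: W_def \<Theta>_def matrix_mul_assoc PP)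
  have neg: "(- A) ** B = - (A ** B)" for A B :: "real^3^3"
    using bounded_bilinear.minus_left[OF bounded_bilinear_matrix_matrix_mult] .
  have cancel: "transpose (P ** A) ** (P ** B) = transpose A ** B" for A B :: "real^3^3"
    by (metis PP(2) matrix_mul_assoc matrix_mul_lid matrix_transpose_mul)
  have "transpose Pt ** Pn = - (W ** \<Theta>)" "transpose Pn ** Pt = - (\<Theta> ** W)"
    by (simp_all add: Pt Pn cancel skew neg)
  \<comment> \<open>The two sides of the claim differ by a commutator, whose axial vector is exactly
    what the derivative \<open>Pt\<close> of the frame contributes.\<close>
  moreover have "transpose P ** Ptn - \<Theta> ** W = transpose P ** Ptn - W ** \<Theta> + (W ** \<Theta> - \<Theta> ** W)"
    by simp
  then have "skew_axis (transpose P ** Ptn - \<Theta> ** W) =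
      skew_axis (transpose P ** Ptn - W ** \<Theta>) + W *v skew_axis \<Theta>"
    using skew_axis_commutator[OF skew] linear_add[OF bounded_linear.linear[OF bounded_linear_skew_axis]]
    by metis
  ultimately show ?thesis
    by (simp add: \<Theta>_def[symmetric] Pt matrix_vector_mul_assoc[symmetric] matrix_vector_right_distrib)
qed

section \<open>Second partial derivatives of a one-parameter family\<close>

text \<open>\<open>fSn\<close> and \<open>ftn\<close> each appear as the derivative in both orders,
  so the last two clauses say that the variation commutes with the partials in \<open>S\<close> and
  \<open>t\<close>. Strains are differentiated only in \<open>S\<close> and velocities only in
  \<open>t\<close>, hence no mixed derivative in \<open>S\<close> and \<open>t\<close>
  occurs.\<close>

locale second_partials =
  fixes U I J :: "real set"
    and f fn fS ft fSS ftt fSn ftn :: "real \<times> real \<times> real \<Rightarrow> 'b::banach"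
  assumes cont:
    "continuous_on (U \<times> I \<times> J) fn" "continuous_on (U \<times> I \<times> J) fS"
    "continuous_on (U \<times> I \<times> J) ft" "continuous_on (U \<times> I \<times> J) fSS"
    "continuous_on (U \<times> I \<times> J) ftt" "continuous_on (U \<times> I \<times> J) fSn"
    "continuous_on (U \<times> I \<times> J) ftn"
    and deriv: "\<And>n s t. n \<in> U \<Longrightarrow> s \<in> I \<Longrightarrow> t \<in> J \<Longrightarrow>
        ((\<lambda>n. f (n, s, t)) has_vector_derivative fn (n, s, t)) (at n within U)"
      "\<And>n s t. n \<in> U \<Longrightarrow> s \<in> I \<Longrightarrow> t \<in> J \<Longrightarrow>
        ((\<lambda>s. f (n, s, t)) has_vector_derivative fS (n, s, t)) (at s within I)"
      "\<And>n s t. n \<in> U \<Longrightarrow> s \<in> I \<Longrightarrow> t \<in> J \<Longrightarrow>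
        ((\<lambda>t. f (n, s, t)) has_vector_derivative ft (n, s, t)) (at t within J)"
      "\<And>n s t. n \<in> U \<Longrightarrow> s \<in> I \<Longrightarrow> t \<in> J \<Longrightarrow>
        ((\<lambda>s. fS (n, s, t)) has_vector_derivative fSS (n, s, t)) (at s within I)"
      "\<And>n s t. n \<in> U \<Longrightarrow> s \<in> I \<Longrightarrow> t \<in> J \<Longrightarrow>
        ((\<lambda>t. ft (n, s, t)) has_vector_derivative ftt (n, s, t)) (at t within J)"
      "\<And>n s t. n \<in> U \<Longrightarrow> s \<in> I \<Longrightarrow> t \<in> J \<Longrightarrow>
        ((\<lambda>n. fS (n, s, t)) has_vector_derivative fSn (n, s, t)) (at n within U)"
      "\<And>n s t. n \<in> U \<Longrightarrow> s \<in> I \<Longrightarrow> t \<in> J \<Longrightarrow>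
        ((\<lambda>n. ft (n, s, t)) has_vector_derivative ftn (n, s, t)) (at n within U)"
      "\<And>n s t. n \<in> U \<Longrightarrow> s \<in> I \<Longrightarrow> t \<in> J \<Longrightarrow>
        ((\<lambda>s. fn (n, s, t)) has_vector_derivative fSn (n, s, t)) (at s within I)"
      "\<And>n s t. n \<in> U \<Longrightarrow> s \<in> I \<Longrightarrow> t \<in> J \<Longrightarrow>
        ((\<lambda>t. fn (n, s, t)) has_vector_derivative ftn (n, s, t)) (at t within J)"

text \<open>Splitting class 2 twice gives all derivatives except those of \<open>fn\<close>. These
  come from \<open>mixed_partials_interchange\<close>, with the parameter as the variable in the
  open set.\<close>

lemma second_partials_exist:
  fixes f :: "real \<times> real \<times> real \<Rightarrow> 'b::banach"
  assumes U: "open U" "convex U" and f: "Ck_on 2 (U \<times> {a..b} \<times> {c..d}) f"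
  obtains fn fS ft fSS ftt fSn ftn where "second_partials U {a..b} {c..d} f fn fS ft fSS ftt fSn ftn"
proof -
  let ?D = "U \<times> {a..b} \<times> {c..d}"
  from f have "Ck_on (Suc (Suc 0)) ?D f"
    by (simp add: numeral_2_eq_2)
  then obtain fn fS ft where C1: "Ck_on (Suc 0) ?D fn" "Ck_on (Suc 0) ?D fS" "Ck_on (Suc 0) ?D ft"
    and df: "\<And>n s t. n \<in> U \<Longrightarrow> s \<in> {a..b} \<Longrightarrow> t \<in> {c..d} \<Longrightarrow>
        ((\<lambda>n. f (n, s, t)) has_vector_derivative fn (n, s, t)) (at n within U)"
      "\<And>n s t. n \<in> U \<Longrightarrow> s \<in> {a..b} \<Longrightarrow> t \<in> {c..d} \<Longrightarrow>
        ((\<lambda>s. f (n, s, t)) has_vector_derivative fS (n, s, t)) (at s within {a..b})"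
      "\<And>n s t. n \<in> U \<Longrightarrow> s \<in> {a..b} \<Longrightarrow> t \<in> {c..d} \<Longrightarrow>
        ((\<lambda>t. f (n, s, t)) has_vector_derivative ft (n, s, t)) (at t within {c..d})"
    by (rule Ck_on_Suc_partials) blast
  from C1(2) obtain fSn fSS where C0_S: "Ck_on 0 ?D fSn" "Ck_on 0 ?D fSS"
    and dfS: "\<And>n s t. n \<in> U \<Longrightarrow> s \<in> {a..b} \<Longrightarrow> t \<in> {c..d} \<Longrightarrow>
        ((\<lambda>n. fS (n, s, t)) has_vector_derivative fSn (n, s, t)) (at n within U)"
      "\<And>n s t. n \<in> U \<Longrightarrow> s \<in> {a..b} \<Longrightarrow> t \<in> {c..d} \<Longrightarrow>
        ((\<lambda>s. fS (n, s, t)) has_vector_derivative fSS (n, s, t)) (at s within {a..b})"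
    by (rule Ck_on_Suc_partials) blast
  from C1(3) obtain ftn ftt where C0_t: "Ck_on 0 ?D ftn" "Ck_on 0 ?D ftt"
    and dft: "\<And>n s t. n \<in> U \<Longrightarrow> s \<in> {a..b} \<Longrightarrow> t \<in> {c..d} \<Longrightarrow>
        ((\<lambda>n. ft (n, s, t)) has_vector_derivative ftn (n, s, t)) (at n within U)"
      "\<And>n s t. n \<in> U \<Longrightarrow> s \<in> {a..b} \<Longrightarrow> t \<in> {c..d} \<Longrightarrow>
        ((\<lambda>t. ft (n, s, t)) has_vector_derivative ftt (n, s, t)) (at t within {c..d})"
    by (rule Ck_on_Suc_partials) blast
  note cont = C1[THEN Ck_on_imp_continuous_on] C0_S[THEN Ck_on_imp_continuous_on]
    C0_t[THEN Ck_on_imp_continuous_on]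
  have slice_S: "continuous_on (T \<times> {a..b}) (\<lambda>(n, s). h (n, s, t))"
    if "continuous_on ?D h" "t \<in> {c..d}" "T \<subseteq> U" for h :: "real \<times> real \<times> real \<Rightarrow> 'b" and T t
    unfolding split_beta using that(2,3)
    by (intro continuous_on_compose2[OF that(1)] continuous_intros) auto
  have slice_t: "continuous_on (T \<times> {c..d}) (\<lambda>(n, t). h (n, s, t))"
    if "continuous_on ?D h" "s \<in> {a..b}" "T \<subseteq> U" for h :: "real \<times> real \<times> real \<Rightarrow> 'b" and T s
    unfolding split_beta using that(2,3)
    by (intro continuous_on_compose2[OF that(1)] continuous_intros) auto
  have line_S: "continuous_on {a..b} (\<lambda>s. h (n, s, t))"
    if "continuous_on ?D h" "n \<in> U" "t \<in> {c..d}" for h :: "real \<times> real \<times> real \<Rightarrow> 'b" and n t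
    using that(2,3) by (intro continuous_on_compose2[OF that(1)] continuous_intros) auto
  have line_t: "continuous_on {c..d} (\<lambda>t. h (n, s, t))"
    if "continuous_on ?D h" "n \<in> U" "s \<in> {a..b}" for h :: "real \<times> real \<times> real \<Rightarrow> 'b" and n s
    using that(2,3) by (intro continuous_on_compose2[OF that(1)] continuous_intros) auto
  have mixed: "((\<lambda>s. fn (n, s, t)) has_vector_derivative fSn (n, s, t)) (at s within {a..b})"
    "((\<lambda>t. fn (n, s, t)) has_vector_derivative ftn (n, s, t)) (at t within {c..d})"
    if "n \<in> U" "s \<in> {a..b}" "t \<in> {c..d}" for n s t
  proof -
    show "((\<lambda>s. fn (n, s, t)) has_vector_derivative fSn (n, s, t)) (at s within {a..b})"
      by (rule mixed_partials_interchange[OF U, where f = "\<lambda>n s. f (n, s, t)" and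
          fx = "\<lambda>n s. fn (n, s, t)" and fy = "\<lambda>n s. fS (n, s, t)" and fyx = "\<lambda>n s. fSn (n, s, t)"])
        (use that df dfS line_S[OF cont(2)] slice_S[OF cont(4)] in auto)
    show "((\<lambda>t. fn (n, s, t)) has_vector_derivative ftn (n, s, t)) (at t within {c..d})"
      by (rule mixed_partials_interchange[OF U, where f = "\<lambda>n t. f (n, s, t)" and
          fx = "\<lambda>n t. fn (n, s, t)" and fy = "\<lambda>n t. ft (n, s, t)" and fyx = "\<lambda>n t. ftn (n, s, t)"])
        (use that df dft line_t[OF cont(3)] slice_t[OF cont(6)] in auto)
  qed
  show thesis
    by (rule that, unfold_locales)
      (fact cont(1-3) cont(5) cont(7) cont(4) cont(6) df dfS(2) dft(2) dfS(1) dft(1) mixed)+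
qed

section \<open>One-sided partials, tensors and work in the moving frame\<close>

text \<open>A nondegenerate interval makes the one-sided derivative unique. Agreement with
  \<open>g\<close> on the interval is enough, which matters because the fields are controlled only
  on the rectangle.\<close>

lemma pd_S_eqI:
  fixes g :: "real \<Rightarrow> 'b::euclidean_space"
  assumes "(g has_vector_derivative g') (at S within {0..L})" "0 < L" "S \<in> {0..L}"
    and "\<And>s. s \<in> {0..L} \<Longrightarrow> f s t = g s"
  shows "pd_S L f S t = g'"
  unfolding pd_S_def using assms
  by (intro vector_derivative_within_closed_interval has_vector_derivative_transform[OF _ _ assms(1)])

lemma pd_t_eqI:
  fixes g :: "real \<Rightarrow> 'b::euclidean_space"
  assumes "(g has_vector_derivative g') (at t within {t1..t2})" "t1 < t2" "t \<in> {t1..t2}"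
    and "\<And>\<tau>. \<tau> \<in> {t1..t2} \<Longrightarrow> f S \<tau> = g \<tau>"
  shows "pd_t t1 t2 f S t = g'"
  unfolding pd_t_def using assms
  by (intro vector_derivative_within_closed_interval has_vector_derivative_transform[OF _ _ assms(1)])

lemma apply_tensor_frame:
  assumes "orthogonal_matrix (R S t)" "u S t = R S t *v w"
  shows "apply_tensor X R u S t = R S t *v (X *v w)"
  using assms by (simp add: apply_tensor_def orthogonal_matrix_inv orthogonal_matrix matrix_vector_mul_assoc
    del: transpose_matrix_vector)

lemma inner_orthogonal_matrix:
  fixes P :: "real^'n^'n"
  assumes "orthogonal_matrix P"
  shows "(P *v x) \<bullet> (P *v y) = x \<bullet> y"
  using assms by (metis orthogonal_matrix dot_lmul_matrix matrix_vector_mul_assoc matrix_vector_mul_lid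
    transpose_matrix_vector)

text \<open>Symmetry of \<open>X\<close> makes the two terms of the product rule equal, which
  cancels the factor 1/2.\<close>

lemma quadratic_form_has_vector_derivative:
  fixes f :: "real \<Rightarrow> real^'n"
  assumes "transpose X = X" "(f has_vector_derivative f') (at s within T)"
  shows "((\<lambda>s. 1/2 * (f s \<bullet> (X *v f s))) has_vector_derivative f' \<bullet> (X *v f s)) (at s within T)"
proof -
  have "((\<lambda>s. 1/2 * (f s \<bullet> (X *v f s))) has_vector_derivative
      1/2 * (f s \<bullet> (X *v f') + f' \<bullet> (X *v f s))) (at s within T)"
    by (intro has_vector_derivative_mult_right
      bounded_bilinear.has_vector_derivative[OF bounded_bilinear_inner]
      bounded_linear.has_vector_derivative[OF matrix_vector_mul_bounded_linear] assms(2))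
  moreover have "f s \<bullet> (X *v f') = f' \<bullet> (X *v f s)"
    by (metis assms(1) dot_lmul_matrix inner_commute transpose_matrix_vector)
  ultimately show ?thesis
    by simp
qed

lemma frame_derivative_mult:
  assumes "orthogonal_matrix P" "transpose (transpose P ** Pn) = - (transpose P ** Pn)"
  shows "Pn *v y = P *v cross3 (skew_axis (transpose P ** Pn)) y"
  using assms by (simp add: skew_axis_cross3[symmetric] matrix_vector_mul_assoc matrix_mul_assoc
    orthogonal_matrix_def)

text \<open>The source of the couple \<open>cross3 FS (P *v y)\<close> in the moment balance. Moving
  \<open>transpose Pn\<close> to the other factor gives \<open>Pn *v y\<close>, the frame times a
  cross product with the axial vector. A rotation commutes with the cross product (determinant one
  is used here), and the triple product then isolates the variation of the frame.\<close>

lemma strain_variation_work: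
  assumes P: "rotation_matrix P" and skew: "transpose (transpose P ** Pn) = - (transpose P ** Pn)"
  shows "(transpose P *v FSn + transpose Pn *v FS) \<bullet> y =
    FSn \<bullet> (P *v y) - (P *v skew_axis (transpose P ** Pn)) \<bullet> cross3 FS (P *v y)"
proof -
  have adj: "(transpose A *v x) \<bullet> y = x \<bullet> (A *v y)" for A :: "real^3^3" and x y
    by (simp add: dot_lmul_matrix)
  have triple: "x \<bullet> cross3 y z = - (y \<bullet> cross3 x z)" for x y z :: "real^3"
    by (simp add: cross3_simps)
  have "orthogonal_matrix P"
    using P by (simp add: rotation_matrix_def)
  then show ?thesis
    using P skew by (simp add: inner_add_left adj triple frame_derivative_mult cross_rotation_matrix
      del: transpose_matrix_vector)
qed

lemma transpose_diag3: "transpose (diag3 x y z) = diag3 x y z"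
  by (simp add: diag3_def transpose_def vec_eq_iff)

section \<open>Variation of the action and the weak equations of motion\<close>

theorem theorem3p2:
  fixes L t1 t2 E G A \<rho> I1 I2 I3 a :: real
    and \<phi> :: "real \<Rightarrow> real \<Rightarrow> real^3" and R :: "real \<Rightarrow> real \<Rightarrow> real^3^3"
    and \<Phi> :: "real \<Rightarrow> real \<Rightarrow> real \<Rightarrow> real^3" and Q :: "real \<Rightarrow> real \<Rightarrow> real \<Rightarrow> real^3^3"
    and GG HH AA JJ :: "real^3^3"
    and \<delta>\<phi> \<delta>\<theta> :: "real \<Rightarrow> real \<Rightarrow> real^3"
  assumes domain: "0 < L" "t1 < t2"
    and constants: "0 < E" "0 < G" "0 < A" "0 < \<rho>" "0 < I1" "0 < I2" "0 < I3"
    and tensors: "GG = diag3 (G * A) (G * A) (E * A)"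
      "HH = diag3 (E * I1) (E * I2) (G * I3)"
      "AA = (\<rho> * A) *\<^sub>R mat 1"
      "JJ = \<rho> *\<^sub>R diag3 I1 I2 I3"
    and configuration: "smooth_on ({0..L} \<times> {t1..t2}) (\<lambda>(S, t). \<phi> S t)"
      "smooth_on ({0..L} \<times> {t1..t2}) (\<lambda>(S, t). R S t)"
      "\<And>S t. S \<in> {0..L} \<Longrightarrow> t \<in> {t1..t2} \<Longrightarrow> rotation_matrix (R S t)"
    and family: "0 < a"
      "smooth_on ({-a<..<a} \<times> {0..L} \<times> {t1..t2}) (\<lambda>(\<nu>, S, t). \<Phi> \<nu> S t)"
      "smooth_on ({-a<..<a} \<times> {0..L} \<times> {t1..t2}) (\<lambda>(\<nu>, S, t). Q \<nu> S t)"
      "\<And>\<nu> S t. \<nu> \<in> {-a<..<a} \<Longrightarrow> S \<in> {0..L} \<Longrightarrow> t \<in> {t1..t2} \<Longrightarrow> rotation_matrix (Q \<nu> S t)"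
      "\<And>S t. S \<in> {0..L} \<Longrightarrow> t \<in> {t1..t2} \<Longrightarrow> \<Phi> 0 S t = \<phi> S t"
      "\<And>S t. S \<in> {0..L} \<Longrightarrow> t \<in> {t1..t2} \<Longrightarrow> Q 0 S t = R S t"
    and variations: "\<delta>\<phi> = var_\<phi> \<Phi>" "\<delta>\<theta> = var_\<theta> Q"
    and fixed_times: "\<And>S t. S \<in> {0..L} \<Longrightarrow> t \<in> {t1, t2} \<Longrightarrow> \<delta>\<phi> S t = 0"
      "\<And>S t. S \<in> {0..L} \<Longrightarrow> t \<in> {t1, t2} \<Longrightarrow> \<delta>\<theta> S t = 0"
    and boundary:
      "\<And>S t. S \<in> {0, L} \<Longrightarrow> t \<in> {t1..t2} \<Longrightarrow> \<delta>\<phi> S t \<bullet> apply_tensor GG R (strain L \<phi> R) S t = 0"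
      "\<And>S t. S \<in> {0, L} \<Longrightarrow> t \<in> {t1..t2} \<Longrightarrow> \<delta>\<theta> S t \<bullet> apply_tensor HH R (curvature L R) S t = 0"
  shows "((\<lambda>\<nu>. action L t1 t2 AA JJ GG HH (\<Phi> \<nu>) (Q \<nu>)) has_real_derivative 0) (at 0) \<longleftrightarrow>
    integral {t1..t2} (\<lambda>t. integral {0..L} (\<lambda>S.
        \<delta>\<phi> S t \<bullet> (pd_S L (apply_tensor GG R (strain L \<phi> R)) S t
                   - pd_t t1 t2 (apply_tensor AA R (velocity t1 t2 \<phi>)) S t)
      + \<delta>\<theta> S t \<bullet> (pd_S L (apply_tensor HH R (curvature L R)) S t
                   + cross3 (pd_S L \<phi> S t) (apply_tensor GG R (strain L \<phi> R) S t)
                   - pd_t t1 t2 (apply_tensor JJ R (spin t1 t2 R)) S t))) = 0"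
proof -
  define U where "U = {-a<..<a}"
  define D where "D = U \<times> {0..L} \<times> {t1..t2}"
  define c where "c = \<rho> * A"
  define F where "F = (\<lambda>(\<nu>, S, t). \<Phi> \<nu> S t)"
  define P where "P = (\<lambda>(\<nu>, S, t). Q \<nu> S t)"
  have U: "open U" "convex U" "0 \<in> U"
    using \<open>0 < a\<close> by (auto simp: U_def)
  have at_U: "at n within U = at n" if "n \<in> U" for n
    using that U(1) by (rule at_within_open)
  have \<Phi>F: "\<Phi> \<nu> S t = F (\<nu>, S, t)" and QP: "Q \<nu> S t = P (\<nu>, S, t)" for \<nu> S t
    by (simp_all add: F_def P_def)
  \<comment> \<open>Class 2 is enough: the density contains first derivatives, and the equations of
    motion differentiate these once more.\<close>
  have F2: "Ck_on 2 (U \<times> {0..L} \<times> {t1..t2}) F" and P2: "Ck_on 2 (U \<times> {0..L} \<times> {t1..t2}) P"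
    using family(2,3) by (simp_all add: smooth_on_def U_def F_def P_def)
  obtain Fn FS Ft FSS Ftt FSn Ftn where "second_partials U {0..L} {t1..t2} F Fn FS Ft FSS Ftt FSn Ftn"
    by (rule second_partials_exist[OF U(1,2) F2])
  then interpret F: second_partials U "{0..L}" "{t1..t2}" F Fn FS Ft FSS Ftt FSn Ftn .
  obtain Pn PS Pt PSS Ptt PSn Ptn where "second_partials U {0..L} {t1..t2} P Pn PS Pt PSS Ptt PSn Ptn"
    by (rule second_partials_exist[OF U(1,2) P2])
  then interpret P: second_partials U "{0..L}" "{t1..t2}" P Pn PS Pt PSS Ptt PSn Ptn .
  note contF = F.cont[folded D_def] and contP = P.cont[folded D_def]
  note dF = F.deriv and dP = P.deriv
  have contP0: "continuous_on D P"
    using Ck_on_imp_continuous_on[OF P2] by (simp add: D_def)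
  have rot: "rotation_matrix (P p)" if "p \<in> D" for p
    using that family(4) by (auto simp: D_def U_def P_def)
  then have orth: "orthogonal_matrix (P p)" if "p \<in> D" for p
    using that by (simp add: rotation_matrix_def)

  \<comment> \<open>The orthogonality constraint is differentiated in each of the three variables.
    At the edges the derivatives are one-sided, and \<open>domain\<close> keeps the filters
    nontrivial.\<close>
  have skew_n: "transpose (transpose (P p) ** Pn p) = - (transpose (P p) ** Pn p)" if "p \<in> D" for p
  proof -
    obtain n s t where p: "p = (n, s, t)" "n \<in> U" "s \<in> {0..L}" "t \<in> {t1..t2}"
      using \<open>p \<in> D\<close> by (auto simp: D_def)
    have "at n within U \<noteq> bot"
      using at_U[OF p(2)] by simp
    with p show ?thesis
      by (auto intro!: orthogonal_derivative_skew[OF dP(1)[OF p(2-4)]] orth simp: D_def)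
  qed
  have skew_S: "transpose (transpose (P p) ** PS p) = - (transpose (P p) ** PS p)" if "p \<in> D" for p
  proof -
    obtain n s t where p: "p = (n, s, t)" "n \<in> U" "s \<in> {0..L}" "t \<in> {t1..t2}"
      using \<open>p \<in> D\<close> by (auto simp: D_def)
    have "at s within {0..L} \<noteq> bot"
      using p(3) domain(1) by (simp add: trivial_limit_within)
    with p show ?thesis
      by (auto intro!: orthogonal_derivative_skew[OF dP(2)[OF p(2-4)]] orth simp: D_def)
  qed
  have skew_t: "transpose (transpose (P p) ** Pt p) = - (transpose (P p) ** Pt p)" if "p \<in> D" for p
  proof -
    obtain n s t where p: "p = (n, s, t)" "n \<in> U" "s \<in> {0..L}" "t \<in> {t1..t2}"
      using \<open>p \<in> D\<close> by (auto simp: D_def)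
    have "at t within {t1..t2} \<noteq> bot"
      using p(4) domain(2) by (simp add: trivial_limit_within)
    with p show ?thesis
      by (auto intro!: orthogonal_derivative_skew[OF dP(3)[OF p(2-4)]] orth simp: D_def)
  qed

  \<comment> \<open>Suffixes \<open>n\<close>, \<open>S\<close>, \<open>t\<close> mark derivatives.
    \<open>\<theta>\<close>, \<open>w\<close>, \<open>k\<close>, \<open>e\<close> are moving
    components, whereas \<open>Ge\<close>, \<open>Hk\<close>, \<open>Jw\<close> are ambient vectors,
    so \<open>GeS\<close>, \<open>HkS\<close>, \<open>Jwt\<close> also contain the derivative of the
    frame.\<close>
  define \<theta> where "\<theta> p = skew_axis (transpose (P p) ** Pn p)" for p
  define w where "w p = skew_axis (transpose (P p) ** Pt p)" for p
  define k where "k p = skew_axis (transpose (P p) ** PS p)" for p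
  define e where "e p = transpose (P p) *v FS p - axis 3 1" for p
  define wn where "wn p = skew_axis (transpose (P p) ** Ptn p + transpose (Pn p) ** Pt p)" for p
  define kn where "kn p = skew_axis (transpose (P p) ** PSn p + transpose (Pn p) ** PS p)" for p
  define en where "en p = transpose (P p) *v FSn p + transpose (Pn p) *v FS p" for p
  define wt where "wt p = skew_axis (transpose (P p) ** Ptt p + transpose (Pt p) ** Pt p)" for p
  define kS where "kS p = skew_axis (transpose (P p) ** PSS p + transpose (PS p) ** PS p)" for p
  define eS where "eS p = transpose (P p) *v FSS p + transpose (PS p) *v FS p" for p
  define Ge where "Ge p = P p *v (GG *v e p)" for p
  define Hk where "Hk p = P p *v (HH *v k p)" for p
  define Jw where "Jw p = P p *v (JJ *v w p)" for p
  define GeS where "GeS p = P p *v (GG *v eS p) + PS p *v (GG *v e p)" for p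
  define HkS where "HkS p = P p *v (HH *v kS p) + PS p *v (HH *v k p)" for p
  define Jwt where "Jwt p = P p *v (JJ *v wt p) + Pt p *v (JJ *v w p)" for p
  \<comment> \<open>The Lagrangian density in moving components, except that the translational
    inertia is a multiple of the identity and acts on the ambient velocity. Writing it with
    \<open>mat 1\<close> makes every term a quadratic form of the same shape.\<close>
  define g where "g p = c * (1/2 * (Ft p \<bullet> (mat 1 *v Ft p))) + 1/2 * (w p \<bullet> (JJ *v w p))
    - 1/2 * (e p \<bullet> (GG *v e p)) - 1/2 * (k p \<bullet> (HH *v k p))" for p
  define g' where "g' p = c * (Ftn p \<bullet> (mat 1 *v Ft p)) + wn p \<bullet> (JJ *v w p)
    - en p \<bullet> (GG *v e p) - kn p \<bullet> (HH *v k p)" for p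
  define h where "h p = Fn p \<bullet> (GeS p - c *\<^sub>R Ftt p)
    + (P p *v \<theta> p) \<bullet> (HkS p + cross3 (FS p) (Ge p) - Jwt p)" for p
  define X where "X p = Fn p \<bullet> (c *\<^sub>R Ft p) + (P p *v \<theta> p) \<bullet> Jw p" for p
  define Xt where "Xt p = Fn p \<bullet> (c *\<^sub>R Ftt p) + Ftn p \<bullet> (c *\<^sub>R Ft p)
    + ((P p *v \<theta> p) \<bullet> Jwt p + (P p *v wn p) \<bullet> Jw p)" for p
  define Y where "Y p = Fn p \<bullet> Ge p + (P p *v \<theta> p) \<bullet> Hk p" for p
  define YS where "YS p = Fn p \<bullet> GeS p + FSn p \<bullet> Ge p
    + ((P p *v \<theta> p) \<bullet> HkS p + (P p *v kn p) \<bullet> Hk p)" for p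

  note cont_intros = continuous_intros continuous_on_matrix continuous_on_cross contF contP contP0
  have cont: "continuous_on D g" "continuous_on D g'" "continuous_on D h" "continuous_on D Xt"
    "continuous_on D YS"
    unfolding g_def g'_def h_def Xt_def YS_def Ge_def Hk_def Jw_def GeS_def HkS_def Jwt_def
      w_def k_def e_def wn_def kn_def en_def wt_def kS_def eS_def \<theta>_def
    by (intro cont_intros)+

  have symmetric: "transpose GG = GG" "transpose HH = HH" "transpose JJ = JJ"
    by (simp_all add: tensors transpose_scalar transpose_diag3)
  note linear_diff = bounded_linear.has_vector_derivative[OF matrix_vector_mul_bounded_linear]
  note inner_diff = bounded_bilinear.has_vector_derivative[OF bounded_bilinear_inner]

  \<comment> \<open>\<open>frame_rate_variation\<close> is used from right to left, once with
    \<open>PS\<close> and once with \<open>Pt\<close>, so that the claimed derivative becomes the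
    product rule for the frame applied to \<open>\<theta>\<close>.\<close>
  have dtheta: "((\<lambda>s. P (n, s, t) *v \<theta> (n, s, t)) has_vector_derivative P (n, s, t) *v kn (n, s, t))
        (at s within {0..L})"
    "((\<lambda>t. P (n, s, t) *v \<theta> (n, s, t)) has_vector_derivative P (n, s, t) *v wn (n, s, t))
        (at t within {t1..t2})"
    if nst: "n \<in> U" "s \<in> {0..L}" "t \<in> {t1..t2}" for n s t
  proof -
    have D: "(n, s, t) \<in> D"
      using nst by (simp add: D_def)
    show "((\<lambda>s. P (n, s, t) *v \<theta> (n, s, t)) has_vector_derivative P (n, s, t) *v kn (n, s, t))
        (at s within {0..L})"
      unfolding \<theta>_def kn_def frame_rate_variation[OF orth[OF D] skew_S[OF D] skew_n[OF D], symmetric]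
      by (intro has_vector_derivative_matrix dP nst)
    show "((\<lambda>t. P (n, s, t) *v \<theta> (n, s, t)) has_vector_derivative P (n, s, t) *v wn (n, s, t))
        (at t within {t1..t2})"
      unfolding \<theta>_def wn_def frame_rate_variation[OF orth[OF D] skew_t[OF D] skew_n[OF D], symmetric]
      by (intro has_vector_derivative_matrix dP nst)
  qed
  have dforce: "((\<lambda>s. Ge (n, s, t)) has_vector_derivative GeS (n, s, t)) (at s within {0..L})"
    "((\<lambda>s. Hk (n, s, t)) has_vector_derivative HkS (n, s, t)) (at s within {0..L})"
    "((\<lambda>t. Jw (n, s, t)) has_vector_derivative Jwt (n, s, t)) (at t within {t1..t2})"
    if nst: "n \<in> U" "s \<in> {0..L}" "t \<in> {t1..t2}" for n s t
  proof -
    \<comment> \<open>The subtracted 0 is the derivative of the constant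
      \<open>axis 3 1\<close>.\<close>
    have "((\<lambda>s. e (n, s, t)) has_vector_derivative eS (n, s, t) - 0) (at s within {0..L})"
      unfolding e_def eS_def
      by (intro has_vector_derivative_diff has_vector_derivative_const has_vector_derivative_matrix dF dP nst)
    then show "((\<lambda>s. Ge (n, s, t)) has_vector_derivative GeS (n, s, t)) (at s within {0..L})"
      unfolding Ge_def GeS_def
      by (intro has_vector_derivative_matrix(2) linear_diff dP nst) simp
    have "((\<lambda>s. k (n, s, t)) has_vector_derivative kS (n, s, t)) (at s within {0..L})"
      unfolding k_def kS_def by (intro has_vector_derivative_matrix dP nst)
    then show "((\<lambda>s. Hk (n, s, t)) has_vector_derivative HkS (n, s, t)) (at s within {0..L})"
      unfolding Hk_def HkS_def by (intro has_vector_derivative_matrix(2) linear_diff dP nst)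
    have "((\<lambda>t. w (n, s, t)) has_vector_derivative wt (n, s, t)) (at t within {t1..t2})"
      unfolding w_def wt_def by (intro has_vector_derivative_matrix dP nst)
    then show "((\<lambda>t. Jw (n, s, t)) has_vector_derivative Jwt (n, s, t)) (at t within {t1..t2})"
      unfolding Jw_def Jwt_def by (intro has_vector_derivative_matrix(2) linear_diff dP nst)
  qed
  have dX: "((\<lambda>t. X (n, s, t)) has_vector_derivative Xt (n, s, t)) (at t within {t1..t2})"
    if nst: "n \<in> U" "s \<in> {0..L}" "t \<in> {t1..t2}" for n s t
    unfolding X_def Xt_def
    by (intro has_vector_derivative_add inner_diff dtheta dforce dF nst
      bounded_linear.has_vector_derivative[OF bounded_linear_scaleR_right])
  have dY: "((\<lambda>s. Y (n, s, t)) has_vector_derivative YS (n, s, t)) (at s within {0..L})"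
    if nst: "n \<in> U" "s \<in> {0..L}" "t \<in> {t1..t2}" for n s t
    unfolding Y_def YS_def by (intro has_vector_derivative_add inner_diff dtheta dforce dF nst)
  have dg: "((\<lambda>n. g (n, s, t)) has_real_derivative g' (n, s, t)) (at n within U)"
    if nst: "n \<in> U" "s \<in> {0..L}" "t \<in> {t1..t2}" for n s t
  proof -
    have "((\<lambda>n. w (n, s, t)) has_vector_derivative wn (n, s, t)) (at n within U)"
      unfolding w_def wn_def by (intro has_vector_derivative_matrix dP nst)
    moreover have "((\<lambda>n. k (n, s, t)) has_vector_derivative kn (n, s, t)) (at n within U)"
      unfolding k_def kn_def by (intro has_vector_derivative_matrix dP nst)
    moreover have "((\<lambda>n. e (n, s, t)) has_vector_derivative en (n, s, t) - 0) (at n within U)"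
      unfolding e_def en_def
      by (intro has_vector_derivative_diff has_vector_derivative_const has_vector_derivative_matrix dF dP nst)
    ultimately show ?thesis
      unfolding g_def g'_def has_real_derivative_iff_has_vector_derivative
      by (intro has_vector_derivative_diff has_vector_derivative_add has_vector_derivative_mult_right
        quadratic_form_has_vector_derivative symmetric transpose_mat dF nst) simp_all
  qed
  \<comment> \<open>\<open>h\<close> is the integrand of the weak form; \<open>X\<close> and \<open>Y\<close> are the fluxes in \<open>t\<close> and \<open>S\<close>.\<close>
  have decompose: "g' p = h p + Xt p - YS p" if "p \<in> D" for p
    unfolding g'_def h_def Xt_def YS_def en_def strain_variation_work[OF rot[OF that] skew_n[OF that]]
    by (simp add: Jw_def Hk_def inner_orthogonal_matrix[OF orth[OF that]] \<theta>_def[symmetric]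
      Ge_def[symmetric] inner_simps algebra_simps)

  \<comment> \<open>Stated for any fields that agree with the family on the rectangle: it serves the
    members of the family as well as \<open>\<phi>\<close> and \<open>R\<close>, which match the
    family at parameter 0 only there.\<close>
  have kin: "velocity t1 t2 \<psi> S t = Ft (n, S, t)"
      "apply_tensor AA R' (velocity t1 t2 \<psi>) S t = c *\<^sub>R Ft (n, S, t)"
      "pd_S L \<psi> S t = FS (n, S, t)"
      "strain L \<psi> R' S t = P (n, S, t) *v e (n, S, t)"
      "spin t1 t2 R' S t = P (n, S, t) *v w (n, S, t)"
      "curvature L R' S t = P (n, S, t) *v k (n, S, t)"
      "apply_tensor GG R' (strain L \<psi> R') S t = Ge (n, S, t)"
      "apply_tensor JJ R' (spin t1 t2 R') S t = Jw (n, S, t)"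
      "apply_tensor HH R' (curvature L R') S t = Hk (n, S, t)"
    if nst: "n \<in> U" "S \<in> {0..L}" "t \<in> {t1..t2}"
      and eq: "\<And>S t. S \<in> {0..L} \<Longrightarrow> t \<in> {t1..t2} \<Longrightarrow> \<psi> S t = F (n, S, t)"
        "\<And>S t. S \<in> {0..L} \<Longrightarrow> t \<in> {t1..t2} \<Longrightarrow> R' S t = P (n, S, t)"
    for n S t and \<psi> :: "real \<Rightarrow> real \<Rightarrow> real^3" and R' :: "real \<Rightarrow> real \<Rightarrow> real^3^3"
  proof -
    have D: "(n, S, t) \<in> D"
      using nst by (simp add: D_def)
    have orthR: "orthogonal_matrix (R' S t)"
      using orth[OF D] eq nst by simp
    have PP: "P (n, S, t) ** transpose (P (n, S, t)) = mat 1"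
      using orth[OF D] by (simp add: orthogonal_matrix_def)
    show v: "velocity t1 t2 \<psi> S t = Ft (n, S, t)"
      unfolding velocity_def by (rule pd_t_eqI[OF dF(3)[OF nst]]) (use nst eq domain in auto)
    show \<psi>S: "pd_S L \<psi> S t = FS (n, S, t)"
      by (rule pd_S_eqI[OF dF(2)[OF nst]]) (use nst eq domain in auto)
    have R'S: "pd_S L R' S t = PS (n, S, t)"
      by (rule pd_S_eqI[OF dP(2)[OF nst]]) (use nst eq domain in auto)
    have R't: "pd_t t1 t2 R' S t = Pt (n, S, t)"
      by (rule pd_t_eqI[OF dP(3)[OF nst]]) (use nst eq domain in auto)
    show e: "strain L \<psi> R' S t = P (n, S, t) *v e (n, S, t)"
      using nst eq by (simp add: strain_def \<psi>S e_def matrix_vector_mult_diff_distrib matrix_vector_mul_assoc PP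
        del: transpose_matrix_vector)
    show w: "spin t1 t2 R' S t = P (n, S, t) *v w (n, S, t)"
      using nst eq orthR by (simp add: spin_def R't w_def orthogonal_matrix_inv axial_eq_skew_axis skew_t[OF D])
    show k: "curvature L R' S t = P (n, S, t) *v k (n, S, t)"
      using nst eq orthR by (simp add: curvature_def R'S k_def orthogonal_matrix_inv axial_eq_skew_axis skew_S[OF D])
    show "apply_tensor GG R' (strain L \<psi> R') S t = Ge (n, S, t)"
      "apply_tensor JJ R' (spin t1 t2 R') S t = Jw (n, S, t)"
      "apply_tensor HH R' (curvature L R') S t = Hk (n, S, t)"
      using nst eq e w k orthR by (simp_all add: apply_tensor_frame Ge_def Jw_def Hk_def)
    have PF: "P (n, S, t) *v (transpose (P (n, S, t)) *v x) = x" for x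
      by (simp add: matrix_vector_mul_assoc PP del: transpose_matrix_vector)
    have AA: "AA *v x = c *\<^sub>R x" for x
      by (simp add: tensors c_def scaleR_matrix_vector_assoc[symmetric])
    \<comment> \<open>The velocity is resolved in the moving frame so that
      \<open>apply_tensor_frame\<close> applies; the frame cancels again because the tensor is a
      scalar.\<close>
    have "velocity t1 t2 \<psi> S t = R' S t *v (transpose (P (n, S, t)) *v Ft (n, S, t))"
      using nst eq by (simp add: v PF del: transpose_matrix_vector)
    from apply_tensor_frame[where R = R' and u = "velocity t1 t2 \<psi>", OF orthR this]
    show "apply_tensor AA R' (velocity t1 t2 \<psi>) S t = c *\<^sub>R Ft (n, S, t)"
      using nst eq PF by (simp add: AA matrix_vector_mult_scaleR del: transpose_matrix_vector)
  qed

  have action: "action L t1 t2 AA JJ GG HH (\<Phi> n) (Q n) =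
      integral {t1..t2} (\<lambda>t. integral {0..L} (\<lambda>S. g (n, S, t)))" if "n \<in> U" for n
    unfolding action_def
  proof (intro integral_cong)
    fix S t assume St: "t \<in> {t1..t2}" "S \<in> {0..L}"
    have D: "(n, S, t) \<in> D"
      using that St by (simp add: D_def)
    note kin' = kin[where \<psi> = "\<Phi> n" and R' = "Q n", OF that St(2,1) \<Phi>F QP]
    show "1/2 * (velocity t1 t2 (\<Phi> n) S t \<bullet> apply_tensor AA (Q n) (velocity t1 t2 (\<Phi> n)) S t)
       + 1/2 * (spin t1 t2 (Q n) S t \<bullet> apply_tensor JJ (Q n) (spin t1 t2 (Q n)) S t)
       - 1/2 * (strain L (\<Phi> n) (Q n) S t \<bullet> apply_tensor GG (Q n) (strain L (\<Phi> n) (Q n)) S t)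
       - 1/2 * (curvature L (Q n) S t \<bullet> apply_tensor HH (Q n) (curvature L (Q n)) S t) = g (n, S, t)"
      unfolding kin' by (simp add: g_def Ge_def Jw_def Hk_def inner_orthogonal_matrix[OF orth[OF D]])
  qed
  let ?I = "integral {t1..t2} (\<lambda>t. integral {0..L} (\<lambda>S. h (0, S, t)))"
  have "((\<lambda>n. integral {t1..t2} (\<lambda>t. integral {0..L} (\<lambda>S. g (n, S, t)))) has_real_derivative
      integral {t1..t2} (\<lambda>t. integral {0..L} (\<lambda>S. g' (0, S, t)))) (at 0)"
    using leibniz_rule_double_integral[OF U dg] cont(1,2) by (simp add: D_def)
  \<comment> \<open>The formula \<open>action\<close> holds for parameters in \<open>U\<close> only;
    \<open>U\<close> is an open neighbourhood of 0, so the derivative carries over.\<close>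
  then have "((\<lambda>n. action L t1 t2 AA JJ GG HH (\<Phi> n) (Q n)) has_real_derivative
      integral {t1..t2} (\<lambda>t. integral {0..L} (\<lambda>S. g' (0, S, t)))) (at 0)"
    by (rule has_field_derivative_transform_within_open[OF _ U(1,3)]) (simp add: action)

  note kin0 = kin[OF U(3), where \<psi> = \<phi> and R' = R]
  have config: "\<phi> S t = F (0, S, t)" "R S t = P (0, S, t)" if "S \<in> {0..L}" "t \<in> {t1..t2}" for S t
    using that family(5,6) by (simp_all add: \<Phi>F QP)
  have var: "\<delta>\<phi> S t = Fn (0, S, t)" "\<delta>\<theta> S t = P (0, S, t) *v \<theta> (0, S, t)"
    if St: "S \<in> {0..L}" "t \<in> {t1..t2}" for S t
  proof -
    have D: "(0, S, t) \<in> D"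
      using St U(3) by (simp add: D_def)
    show "\<delta>\<phi> S t = Fn (0, S, t)"
      using dF(1)[OF U(3) St] by (simp add: variations var_\<phi>_def \<Phi>F at_U[OF U(3)] vector_derivative_at)
    show "\<delta>\<theta> S t = P (0, S, t) *v \<theta> (0, S, t)"
      using dP(1)[OF U(3) St]
      by (simp add: variations var_\<theta>_def QP at_U[OF U(3)] vector_derivative_at orthogonal_matrix_inv[OF orth[OF D]]
        axial_eq_skew_axis skew_n[OF D] \<theta>_def)
  qed
  \<comment> \<open>At the end times both variations vanish. At the ends of the rod they may be
    nonzero, and \<open>Y\<close> vanishes because their products with force and moment do.\<close>
  have X0: "X (0, S, t) = 0" if "S \<in> {0..L}" "t \<in> {t1, t2}" for S t
    using fixed_times[OF that] var[of S t] that domain by (auto simp: X_def)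
  have Y0: "Y (0, S, t) = 0" if "S \<in> {0, L}" "t \<in> {t1..t2}" for S t
    using boundary[OF that] var[of S t] kin0(7,9)[of S t] config that domain by (auto simp: Y_def)
  have slice: "continuous_on ({0..L} \<times> {t1..t2}) (\<lambda>(S, t). f (0, S, t))" if "continuous_on D f"
    for f :: "real \<times> real \<times> real \<Rightarrow> real"
    unfolding split_beta using U(3)
    by (intro continuous_on_compose2[OF that] continuous_intros) (auto simp: D_def)
  have "integral {t1..t2} (\<lambda>t. integral {0..L} (\<lambda>S. g' (0, S, t))) =
      integral {t1..t2} (\<lambda>t. integral {0..L} (\<lambda>S. h (0, S, t) + Xt (0, S, t) - YS (0, S, t)))"
    using U(3) by (intro integral_cong decompose) (simp add: D_def)
  also have "\<dots> = ?I"
    using domain dX[OF U(3)] dY[OF U(3)] X0 Y0 cont[THEN slice]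
    by (intro iterated_integral_partial_derivatives[where X = "\<lambda>S t. X (0, S, t)" and Y = "\<lambda>S t. Y (0, S, t)"])
      auto
  finally have variation: "((\<lambda>n. action L t1 t2 AA JJ GG HH (\<Phi> n) (Q n)) has_real_derivative ?I) (at 0)"
    using \<open>((\<lambda>n. action L t1 t2 AA JJ GG HH (\<Phi> n) (Q n)) has_real_derivative _) (at 0)\<close> by simp

  have "integral {t1..t2} (\<lambda>t. integral {0..L} (\<lambda>S.
        \<delta>\<phi> S t \<bullet> (pd_S L (apply_tensor GG R (strain L \<phi> R)) S t
                   - pd_t t1 t2 (apply_tensor AA R (velocity t1 t2 \<phi>)) S t)
      + \<delta>\<theta> S t \<bullet> (pd_S L (apply_tensor HH R (curvature L R)) S t
                   + cross3 (pd_S L \<phi> S t) (apply_tensor GG R (strain L \<phi> R) S t)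
                   - pd_t t1 t2 (apply_tensor JJ R (spin t1 t2 R)) S t))) = ?I"
  proof (intro integral_cong)
    fix S t assume St: "t \<in> {t1..t2}" "S \<in> {0..L}"
    have "pd_S L (apply_tensor GG R (strain L \<phi> R)) S t = GeS (0, S, t)"
      by (rule pd_S_eqI[OF dforce(1)[OF U(3) St(2,1)]]) (use St domain config in \<open>auto intro!: kin0\<close>)
    moreover have "pd_S L (apply_tensor HH R (curvature L R)) S t = HkS (0, S, t)"
      by (rule pd_S_eqI[OF dforce(2)[OF U(3) St(2,1)]]) (use St domain config in \<open>auto intro!: kin0\<close>)
    moreover have "pd_t t1 t2 (apply_tensor JJ R (spin t1 t2 R)) S t = Jwt (0, S, t)"
      by (rule pd_t_eqI[OF dforce(3)[OF U(3) St(2,1)]]) (use St domain config in \<open>auto intro!: kin0\<close>)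
    moreover have "pd_t t1 t2 (apply_tensor AA R (velocity t1 t2 \<phi>)) S t = c *\<^sub>R Ftt (0, S, t)"
      by (rule pd_t_eqI[OF bounded_linear.has_vector_derivative[OF bounded_linear_scaleR_right
          dF(5)[OF U(3) St(2,1)]]]) (use St domain config in \<open>auto intro!: kin0\<close>)
    ultimately show "\<delta>\<phi> S t \<bullet> (pd_S L (apply_tensor GG R (strain L \<phi> R)) S t
                   - pd_t t1 t2 (apply_tensor AA R (velocity t1 t2 \<phi>)) S t)
      + \<delta>\<theta> S t \<bullet> (pd_S L (apply_tensor HH R (curvature L R)) S t
                   + cross3 (pd_S L \<phi> S t) (apply_tensor GG R (strain L \<phi> R) S t)
                   - pd_t t1 t2 (apply_tensor JJ R (spin t1 t2 R)) S t) = h (0, S, t)"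
      using kin0(3,7)[OF St(2,1) config] var[OF St(2,1)] by (simp add: h_def)
  qed
  \<comment> \<open>The derivative of the action at 0 exists and equals \<open>?I\<close>, so by
    uniqueness it is 0 exactly when \<open>?I\<close> is.\<close>
  with variation show ?thesis
    by (auto dest: DERIV_unique)
qed

end
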